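(* Let $k\ge 2$ and $n=2k$. Let $\phi_R(A_c)=B_c$, $\phi_R(B_c)=A_c$, and $\phi_H(A_c)=A_{n+1-c}$, $\phi_H(B_c)=B_{n+1-c}$. For a total order $\Pi$ of the faces let $\phi(\Pi)$ denote elementwise relabelling and $\operatorname{rev}(\Pi)$ literal reversal. For $P=(h_0,h_1,u_0,u_1,l_0,l_1)\in\{M,V\}^6$ (with $-$ exchanging $M$ and $V$) define the word actions $gP$ and total-order actions $T_g$ by: $C$: $CP=(-h_0,-h_1,-u_0,-u_1,-l_0,-l_1)$, $T_C(\Pi)=\operatorname{rev}(\Pi)$; $R$: $RP=(h_0,h_1,l_0,l_1,u_0,u_1)$, $T_R(\Pi)=\operatorname{rev}(\phi_R(\Pi))$; $H$: $HP=(h_1,h_0,u_0,u_1,l_0,l_1)$, $T_H(\Pi)=\operatorname{rev}(\phi_H(\Pi))$; $CR$: $CRP=(-h_0,-h_1,-l_0,-l_1,-u_0,-u_1)$, $T_{CR}(\Pi)=\phi_R(\Pi)$; $CH$: $CHP=(-h_1,-h_0,-u_0,-u_1,-l_0,-l_1)$, $T_{CH}(\Pi)=\phi_H(\Pi)$. Then for every $g\in\{C,R,H,CR,CH\}$, every $P\in\{M,V\}^6$ and every strict total order $\Pi$ of the $4k$ faces, $$\Pi\in F(P,k)\iff T_g(\Pi)\in F(gP,k),$$ and therefore $F(gP,k)=T_g(F(P,k))$ as literal labelled sets, $T_g$ being a bijection between them. Under horizontal reflection $\phi_H$, the seam between columns $p$ and $p+1$ is sent to the seam between columns $n-p$ and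 $n-p+1$, so the seam coordinate transforms as $p\mapsto n-p$.
   Context: Map and assignment. Let $k\ge2$, $n=2k$. The upper faces are $A_1,\dots,A_n$, the lower faces $B_1,\dots,B_n$. The creases are $H_c=(A_c,B_c)$ ($1\le c\le n$), $U_i=(A_i,A_{i+1})$ and $L_i=(B_i,B_{i+1})$ ($1\le i\le n-1$; these are the seams between columns $i$ and $i+1$); the two faces of a crease are its wings. A word $P=(h_0,h_1,u_0,u_1,l_0,l_1)\in\{M,V\}^6$ assigns to $H_c$ the label $h_{(c-1)\bmod 2}$ and to $U_i,L_i$ the labels $u_{(i-1)\bmod2},l_{(i-1)\bmod2}$. The assignment is locally flat-foldable if for every $1\le c\le n-1$ an odd number of the four creases $H_c,H_{c+1},U_c,L_c$ (meeting at an interior vertex) are labelled $M$. States. $x\prec y$ means $x$ lies above (comes before) $y$ in a total order. A strict total order of all $4k$ labelled faces is order-valid for $P$ if: (i) Precedence: with $A_c$ in row $r=0$ and $B_c$ in row $r=1$, the face in row $r$, column $c$ is light-up iff $r+c-1$ is even and dark-up otherwise; across each $M$ crease the light-up wing precedes the dark-up wing, across each $V$ crease the dark-up wing precedes the light-up wing. (ii) Noncrossing: every $H_c$ has target class $S$; $U_i$ and $L_i$ have class $E$ for $i$ odd and $W$ for $i$ even; for any two distinct creases of the same target class with disjoint wing sets, with wing positions $a_0<a_1$ and $b_0<b_1$ in the order, neither $a_0<b_0<a_1<b_1$ nor $b_0<a_0<b_1<a_1$. $F(P,k)$ is the set of all order-valid strict total orders if $P$ is locally flat-foldable, and $F(P,k)=\varnothing$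 otherwise. *)

theory Defs
  imports Main
begin

datatype face = Upper nat | Lower nat

datatype crease = HCrease nat | UCrease nat | LCrease nat

datatype label = Mountain | Valley

type_synonym word = "label \<times> label \<times> label \<times> label \<times> label \<times> label"

definition faces :: "nat \<Rightarrow> face set" where
  "faces k = Upper ` {1..2 * k} \<union> Lower ` {1..2 * k}"

definition creases :: "nat \<Rightarrow> crease set" where
  "creases k = HCrease ` {1..2 * k} \<union> UCrease ` {1..2 * k - 1} \<union> LCrease ` {1..2 * k - 1}"

fun wings :: "crease \<Rightarrow> face set" where
  "wings (HCrease c) = {Upper c, Lower c}"
| "wings (UCrease i) = {Upper i, Upper (i + 1)}"
| "wings (LCrease i) = {Lower i, Lower (i + 1)}"

fun assigned :: "word \<Rightarrow> crease \<Rightarrow> label" where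
  "assigned (h0, h1, u0, u1, l0, l1) (HCrease c) = (if (c - 1) mod 2 = 0 then h0 else h1)"
| "assigned (h0, h1, u0, u1, l0, l1) (UCrease i) = (if (i - 1) mod 2 = 0 then u0 else u1)"
| "assigned (h0, h1, u0, u1, l0, l1) (LCrease i) = (if (i - 1) mod 2 = 0 then l0 else l1)"

definition locally_flat_foldable :: "word \<Rightarrow> nat \<Rightarrow> bool" where
  "locally_flat_foldable P k \<longleftrightarrow>
     (\<forall>c\<in>{1..2 * k - 1}.
        odd (card {x \<in> {HCrease c, HCrease (c + 1), UCrease c, LCrease c}.
                     assigned P x = Mountain}))"

text \<open>A total order \<open>\<Pi>\<close> is the relation \<open>\<prec>\<close> itself: \<open>(x, y) \<in> \<Pi>\<close> means that \<open>x\<close> lies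
  above (comes before) \<open>y\<close>. Since \<^const>\<open>strict_linear_order_on\<close> does not confine the relation
  to the carrier, this is required separately; otherwise equality of sets of orders would also
  compare pairs of non-faces.\<close>

type_synonym face_order = "(face \<times> face) set"

definition strict_total_order :: "nat \<Rightarrow> face_order \<Rightarrow> bool" where
  "strict_total_order k \<Pi> \<longleftrightarrow> \<Pi> \<subseteq> faces k \<times> faces k \<and> strict_linear_order_on (faces k) \<Pi>"

definition pos :: "face_order \<Rightarrow> face \<Rightarrow> nat" where
  "pos \<Pi> x = card {y. (y, x) \<in> \<Pi>}"

fun row :: "face \<Rightarrow> nat" where
  "row (Upper c) = 0"
| "row (Lower c) = 1"

fun column :: "face \<Rightarrow> nat" where
  "column (Upper c) = c"
| "column (Lower c) = c"

text \<open>A face that is not light-up is dark-up. Columns are at least 1, so the subtraction does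
  not truncate on \<^const>\<open>faces\<close>.\<close>

definition light_up :: "face \<Rightarrow> bool" where
  "light_up x \<longleftrightarrow> even (row x + column x - 1)"

definition precedence :: "word \<Rightarrow> nat \<Rightarrow> face_order \<Rightarrow> bool" where
  "precedence P k \<Pi> \<longleftrightarrow>
     (\<forall>c\<in>creases k. \<forall>x\<in>wings c. \<forall>y\<in>wings c. light_up x \<longrightarrow> \<not> light_up y \<longrightarrow>
        (assigned P c = Mountain \<longrightarrow> (x, y) \<in> \<Pi>) \<and>
        (assigned P c = Valley \<longrightarrow> (y, x) \<in> \<Pi>))"

datatype target = South | East | West

fun target_class :: "crease \<Rightarrow> target" where
  "target_class (HCrease c) = South"
| "target_class (UCrease i) = (if odd i then East else West)"
| "target_class (LCrease i) = (if odd i then East else West)"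

definition noncrossing :: "nat \<Rightarrow> face_order \<Rightarrow> bool" where
  "noncrossing k \<Pi> \<longleftrightarrow>
     (\<forall>c\<in>creases k. \<forall>d\<in>creases k.
        c \<noteq> d \<longrightarrow> target_class c = target_class d \<longrightarrow> wings c \<inter> wings d = {} \<longrightarrow>
        (\<forall>a0 a1 b0 b1.
           pos \<Pi> ` wings c = {a0, a1} \<longrightarrow> a0 < a1 \<longrightarrow>
           pos \<Pi> ` wings d = {b0, b1} \<longrightarrow> b0 < b1 \<longrightarrow>
           \<not> (a0 < b0 \<and> b0 < a1 \<and> a1 < b1) \<and> \<not> (b0 < a0 \<and> a0 < b1 \<and> b1 < a1)))"

definition order_valid :: "word \<Rightarrow> nat \<Rightarrow> face_order \<Rightarrow> bool" where
  "order_valid P k \<Pi> \<longleftrightarrow> strict_total_order k \<Pi> \<and> precedence P k \<Pi> \<and> noncrossing k \<Pi>"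

definition F :: "word \<Rightarrow> nat \<Rightarrow> face_order set" where
  "F P k = (if locally_flat_foldable P k then {\<Pi>. order_valid P k \<Pi>} else {})"

fun phi_R :: "face \<Rightarrow> face" where
  "phi_R (Upper c) = Lower c"
| "phi_R (Lower c) = Upper c"

fun phi_H :: "nat \<Rightarrow> face \<Rightarrow> face" where
  "phi_H k (Upper c) = Upper (2 * k + 1 - c)"
| "phi_H k (Lower c) = Lower (2 * k + 1 - c)"

definition relabel :: "(face \<Rightarrow> face) \<Rightarrow> face_order \<Rightarrow> face_order" where
  "relabel \<phi> \<Pi> = {(\<phi> x, \<phi> y) | x y. (x, y) \<in> \<Pi>}"

datatype symmetry = C | R | H | CR | CH

fun neg :: "label \<Rightarrow> label" where
  "neg Mountain = Valley"
| "neg Valley = Mountain"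

fun word_action :: "symmetry \<Rightarrow> word \<Rightarrow> word" where
  "word_action C (h0, h1, u0, u1, l0, l1) = (neg h0, neg h1, neg u0, neg u1, neg l0, neg l1)"
| "word_action R (h0, h1, u0, u1, l0, l1) = (h0, h1, l0, l1, u0, u1)"
| "word_action H (h0, h1, u0, u1, l0, l1) = (h1, h0, u0, u1, l0, l1)"
| "word_action CR (h0, h1, u0, u1, l0, l1) = (neg h0, neg h1, neg l0, neg l1, neg u0, neg u1)"
| "word_action CH (h0, h1, u0, u1, l0, l1) = (neg h1, neg h0, neg u0, neg u1, neg l0, neg l1)"

fun order_action :: "nat \<Rightarrow> symmetry \<Rightarrow> face_order \<Rightarrow> face_order" where
  "order_action k C \<Pi> = converse \<Pi>"
| "order_action k R \<Pi> = converse (relabel phi_R \<Pi>)"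
| "order_action k H \<Pi> = converse (relabel (phi_H k) \<Pi>)"
| "order_action k CR \<Pi> = relabel phi_R \<Pi>"
| "order_action k CH \<Pi> = relabel (phi_H k) \<Pi>"

text \<open>The seam between columns \<open>p\<close> and \<open>p + 1\<close> consists of the creases \<open>UCrease p\<close> and
  \<open>LCrease p\<close>; a relabelling of faces acts on creases through their wing sets.\<close>

definition seam :: "nat \<Rightarrow> crease set" where
  "seam p = {UCrease p, LCrease p}"

end

theory Submission
  imports Defs
begin

text \<open>The crossing condition depends on the positions only through the order itself: two creases
  cross iff their wings alternate. Alternation is invariant under reversal, which exchanges the
  two creases, and under any relabelling that permutes the creases within their target classes.
  Reversal turns every precedence around, and so does a relabelling that exchanges light-up and
  dark-up faces; both are compensated by negating the labels. This settles \<open>C\<close>, \<open>CR\<close> and \<open>CH\<close>,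
  and \<open>R\<close> and \<open>H\<close> are their composites with \<open>C\<close>. As all these maps are involutions, one
  implication gives the equivalence and the bijection.\<close>

section \<open>Positions, and crossing as alternation in the order\<close>

lemma finite_faces: "finite (faces k)"
  by (simp add: faces_def)

lemma wings_subset_faces: "c \<in> creases k \<Longrightarrow> wings c \<subseteq> faces k"
  by (auto simp: creases_def faces_def)

lemma wings_nonempty: "wings c \<noteq> {}"
  by (cases c) auto

lemma wings_eq_pair: "\<exists>x y. wings c = {x, y}"
  by (cases c; simp; blast)

lemma strict_total_order_iff:
  "strict_total_order k \<Pi> \<longleftrightarrow>
     \<Pi> \<subseteq> faces k \<times> faces k \<and> trans \<Pi> \<and> irrefl \<Pi> \<and> total_on (faces k) \<Pi>"
  by (simp add: strict_total_order_def strict_linear_order_on_def)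

text \<open>If u precedes v, the predecessors of u lie among those of v, and u itself is a further
  one; totality gives the converse. Confinement of \<open>\<Pi>\<close> to faces keeps the
  predecessor sets finite, where \<open>card\<close> really counts.\<close>

lemma pos_less_iff:
  assumes \<Pi>: "strict_total_order k \<Pi>" and "x \<in> faces k" "y \<in> faces k"
  shows "pos \<Pi> x < pos \<Pi> y \<longleftrightarrow> (x, y) \<in> \<Pi>"
proof -
  have sub: "\<Pi> \<subseteq> faces k \<times> faces k" and tr: "trans \<Pi>" and ir: "irrefl \<Pi>"
    and tot: "total_on (faces k) \<Pi>"
    using \<Pi> by (auto simp: strict_total_order_iff)
  have mono: "pos \<Pi> u < pos \<Pi> v" if "(u, v) \<in> \<Pi>" for u v
    unfolding pos_def
  proof (rule psubset_card_mono)
    show "finite {y. (y, v) \<in> \<Pi>}"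
      by (rule finite_subset[OF _ finite_faces[of k]]) (use sub in auto)
    show "{y. (y, u) \<in> \<Pi>} \<subset> {y. (y, v) \<in> \<Pi>}"
      using that tr ir by (auto dest: transD simp: irrefl_def)
  qed
  show ?thesis
    using assms(2,3) tot mono unfolding total_on_def by (metis less_asym less_irrefl)
qed

text \<open>Positions are replaced by the faces occupying them, which makes reversal and relabelling
  easy to follow. One alternation pattern covers both, as \<open>c\<close> and \<open>d\<close>
  range over the same creases and may trade places.\<close>

lemma noncrossing_iff:
  assumes \<Pi>: "strict_total_order k \<Pi>"
  shows "noncrossing k \<Pi> \<longleftrightarrow>
    (\<forall>c\<in>creases k. \<forall>d\<in>creases k. target_class c = target_class d \<longrightarrow> wings c \<inter> wings d = {} \<longrightarrow>
      (\<forall>x0 x1 y0 y1. wings c = {x0, x1} \<longrightarrow> wings d = {y0, y1} \<longrightarrow>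
        \<not> ((x0, y0) \<in> \<Pi> \<and> (y0, x1) \<in> \<Pi> \<and> (x1, y1) \<in> \<Pi>)))"
    (is "_ \<longleftrightarrow> ?alt")
proof
  assume nc: "noncrossing k \<Pi>"
  show ?alt
  proof (intro ballI impI allI notI)
    fix c d x0 x1 y0 y1
    assume cd: "c \<in> creases k" "d \<in> creases k" "target_class c = target_class d"
      "wings c \<inter> wings d = {}"
      and w: "wings c = {x0, x1}" "wings d = {y0, y1}"
      and cross: "(x0, y0) \<in> \<Pi> \<and> (y0, x1) \<in> \<Pi> \<and> (x1, y1) \<in> \<Pi>"
    have "{x0, x1, y0, y1} \<subseteq> faces k"
      using w cd(1,2) wings_subset_faces by blast
    then have less: "pos \<Pi> x0 < pos \<Pi> y0" "pos \<Pi> y0 < pos \<Pi> x1" "pos \<Pi> x1 < pos \<Pi> y1"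
      using cross pos_less_iff[OF \<Pi>] by auto
    have "c \<noteq> d"
      using cd(4) wings_nonempty by auto
    moreover have "pos \<Pi> ` wings c = {pos \<Pi> x0, pos \<Pi> x1}" "pos \<Pi> ` wings d = {pos \<Pi> y0, pos \<Pi> y1}"
      using w by auto
    ultimately show False
      using nc cd less unfolding noncrossing_def by (meson less_trans)
  qed
next
  assume alt: ?alt
  have *: "\<not> (a0 < b0 \<and> b0 < a1 \<and> a1 < b1)"
    if cd: "c \<in> creases k" "d \<in> creases k" "target_class c = target_class d"
      "wings c \<inter> wings d = {}"
      and im: "pos \<Pi> ` wings c = {a0, a1}" "pos \<Pi> ` wings d = {b0, b1}" for c d a0 a1 b0 b1
  proof
    assume less: "a0 < b0 \<and> b0 < a1 \<and> a1 < b1"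
    \<comment> \<open>The image is only an unordered pair, so the wings have to be named in the
      order that matches the given positions.\<close>
    have pick: "\<exists>x y. wings e = {x, y} \<and> pos \<Pi> x = a \<and> pos \<Pi> y = b"
      if "pos \<Pi> ` wings e = {a, b}" for e a b
    proof -
      obtain x y where "wings e = {x, y}"
        using wings_eq_pair by blast
      with that show ?thesis
        by (metis doubleton_eq_iff image_empty image_insert)
    qed
    obtain x0 x1 y0 y1 where w: "wings c = {x0, x1}" "wings d = {y0, y1}"
      and p: "pos \<Pi> x0 = a0" "pos \<Pi> x1 = a1" "pos \<Pi> y0 = b0" "pos \<Pi> y1 = b1"
      using pick im by metis
    have "{x0, x1, y0, y1} \<subseteq> faces k"
      using w cd(1,2) wings_subset_faces by blast
    then have "(x0, y0) \<in> \<Pi> \<and> (y0, x1) \<in> \<Pi> \<and> (x1, y1) \<in> \<Pi>"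
      using less p pos_less_iff[OF \<Pi>] by auto
    with alt cd w show False
      by blast
  qed
  show "noncrossing k \<Pi>"
    unfolding noncrossing_def
  proof (intro ballI impI allI)
    fix c d a0 a1 b0 b1
    assume "c \<in> creases k" "d \<in> creases k" "target_class c = target_class d"
      "wings c \<inter> wings d = {}" "pos \<Pi> ` wings c = {a0, a1}" "pos \<Pi> ` wings d = {b0, b1}"
    then show "\<not> (a0 < b0 \<and> b0 < a1 \<and> a1 < b1) \<and> \<not> (b0 < a0 \<and> a0 < b1 \<and> b1 < a1)"
      using *[of c d a0 a1 b0 b1] *[of d c b0 b1 a0 a1] by (simp add: Int_commute)
  qed
qed

section \<open>Reversal of an order\<close>

lemma neg_eq_iff [simp]: "neg l = Mountain \<longleftrightarrow> l = Valley" "neg l = Valley \<longleftrightarrow> l = Mountain"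
  by (cases l; simp)+

lemma neg_neg [simp]: "neg (neg l) = l"
  by (cases l) auto

lemma order_valid_converse:
  assumes valid: "order_valid P k \<Pi>"
    and neg: "\<And>c. c \<in> creases k \<Longrightarrow> assigned Q c = neg (assigned P c)"
  shows "order_valid Q k (converse \<Pi>)"
proof -
  have \<Pi>: "strict_total_order k \<Pi>"
    using valid by (simp add: order_valid_def)
  have \<Pi>': "strict_total_order k (converse \<Pi>)"
    using \<Pi> by (auto simp: strict_total_order_iff irrefl_def)
  have "precedence Q k (converse \<Pi>)"
    using valid neg by (simp add: order_valid_def precedence_def)
  moreover have "noncrossing k (converse \<Pi>)"
    unfolding noncrossing_iff[OF \<Pi>']
  proof (intro ballI impI allI notI)
    fix c d x0 x1 y0 y1
    assume cd: "c \<in> creases k" "d \<in> creases k" "target_class c = target_class d"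
      "wings c \<inter> wings d = {}"
      and w: "wings c = {x0, x1}" "wings d = {y0, y1}"
      and cross: "(x0, y0) \<in> \<Pi>\<inverse> \<and> (y0, x1) \<in> \<Pi>\<inverse> \<and> (x1, y1) \<in> \<Pi>\<inverse>"
    \<comment> \<open>Read backwards, the pattern x0, y0, x1, y1 becomes y1, x1, y0, x0: again an
      alternation, now with \<open>d\<close> in the first role.\<close>
    have "wings d = {y1, y0}" "wings c = {x1, x0}" "wings d \<inter> wings c = {}"
      using w cd(4) by auto
    moreover have "noncrossing k \<Pi>"
      using valid by (simp add: order_valid_def)
    ultimately show False
      using cd(1-3) cross unfolding noncrossing_iff[OF \<Pi>] converse_iff by metis
  qed
  ultimately show ?thesis
    using \<Pi>' by (simp add: order_valid_def)
qed

section \<open>Relabellings that exchange light-up and dark-up faces\<close>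

text \<open>\<open>\<psi>\<close> is the crease map induced by \<open>\<phi>\<close>. Everything is
  demanded on faces and creases only: truncated subtraction spoils the involution
  \<open>phi_H k\<close> and the parity in \<open>light_up\<close> elsewhere.\<close>

locale light_reversing =
  fixes k :: nat and \<phi> :: "face \<Rightarrow> face" and \<psi> :: "crease \<Rightarrow> crease"
  assumes \<phi>_faces: "x \<in> faces k \<Longrightarrow> \<phi> x \<in> faces k"
    and \<phi>_\<phi>: "x \<in> faces k \<Longrightarrow> \<phi> (\<phi> x) = x"
    and light_up_\<phi>: "x \<in> faces k \<Longrightarrow> light_up (\<phi> x) \<longleftrightarrow> \<not> light_up x"
    and \<psi>_creases: "c \<in> creases k \<Longrightarrow> \<psi> c \<in> creases k"
    and wings_\<psi>: "c \<in> creases k \<Longrightarrow> wings (\<psi> c) = \<phi> ` wings c"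
    and target_class_\<psi>: "c \<in> creases k \<Longrightarrow> target_class (\<psi> c) = target_class c"
begin

text \<open>Being its own inverse on faces, \<open>\<phi>\<close> turns the image in
  \<open>relabel\<close> into a preimage. Membership in \<open>faces k\<close> is stated because
  nothing is known of \<open>\<phi>\<close> outside.\<close>

lemma relabel_iff:
  assumes "\<Pi> \<subseteq> faces k \<times> faces k"
  shows "(x, y) \<in> relabel \<phi> \<Pi> \<longleftrightarrow> x \<in> faces k \<and> y \<in> faces k \<and> (\<phi> x, \<phi> y) \<in> \<Pi>"
proof
  show "x \<in> faces k \<and> y \<in> faces k \<and> (\<phi> x, \<phi> y) \<in> \<Pi>" if "(x, y) \<in> relabel \<phi> \<Pi>"
    using that assms \<phi>_faces \<phi>_\<phi> unfolding relabel_def by auto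
  show "(x, y) \<in> relabel \<phi> \<Pi>" if "x \<in> faces k \<and> y \<in> faces k \<and> (\<phi> x, \<phi> y) \<in> \<Pi>"
    using that \<phi>_\<phi> unfolding relabel_def by force
qed

lemma relabel_relabel:
  assumes "\<Pi> \<subseteq> faces k \<times> faces k"
  shows "relabel \<phi> (relabel \<phi> \<Pi>) = \<Pi>"
proof -
  have "relabel \<phi> \<Pi> \<subseteq> faces k \<times> faces k"
    using relabel_iff[OF assms] by auto
  from relabel_iff[OF this] relabel_iff[OF assms] assms show ?thesis
    using \<phi>_\<phi> \<phi>_faces by auto
qed

lemma strict_total_order_relabel:
  assumes \<Pi>: "strict_total_order k \<Pi>"
  shows "strict_total_order k (relabel \<phi> \<Pi>)"
proof -
  have sub: "\<Pi> \<subseteq> faces k \<times> faces k" and tr: "trans \<Pi>" and ir: "irrefl \<Pi>"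
    and tot: "total_on (faces k) \<Pi>"
    using \<Pi> by (auto simp: strict_total_order_iff)
  note iff = relabel_iff[OF sub]
  have "trans (relabel \<phi> \<Pi>)"
    by (rule transI) (use tr in \<open>auto simp: iff dest: transD\<close>)
  moreover have "irrefl (relabel \<phi> \<Pi>)"
    using ir by (auto simp: iff irrefl_def)
  moreover have "total_on (faces k) (relabel \<phi> \<Pi>)"
    unfolding total_on_def
  proof (intro ballI impI)
    fix x y assume "x \<in> faces k" "y \<in> faces k" "x \<noteq> y"
    moreover from this have "\<phi> x \<noteq> \<phi> y"
      using \<phi>_\<phi> by metis
    ultimately show "(x, y) \<in> relabel \<phi> \<Pi> \<or> (y, x) \<in> relabel \<phi> \<Pi>"
      using tot \<phi>_faces by (simp add: iff total_on_def)
  qed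
  ultimately show ?thesis
    by (auto simp: strict_total_order_iff iff)
qed

text \<open>A condition on \<open>c\<close> in the new order is the condition on
  \<open>\<psi> c\<close> in the old one. There the light-up and dark-up wings have exchanged roles,
  which the negated label compensates.\<close>

lemma order_valid_relabel:
  assumes valid: "order_valid P k \<Pi>"
    and neg: "\<And>c. c \<in> creases k \<Longrightarrow> assigned P (\<psi> c) = neg (assigned Q c)"
  shows "order_valid Q k (relabel \<phi> \<Pi>)"
proof -
  have \<Pi>: "strict_total_order k \<Pi>" and prec: "precedence P k \<Pi>" and nc: "noncrossing k \<Pi>"
    using valid by (auto simp: order_valid_def)
  have \<Pi>': "strict_total_order k (relabel \<phi> \<Pi>)"
    by (rule strict_total_order_relabel[OF \<Pi>])
  have iff: "(x, y) \<in> relabel \<phi> \<Pi> \<longleftrightarrow> x \<in> faces k \<and> y \<in> faces k \<and> (\<phi> x, \<phi> y) \<in> \<Pi>" for x y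
    using \<Pi> by (intro relabel_iff) (simp add: strict_total_order_iff)
  have "precedence Q k (relabel \<phi> \<Pi>)"
    unfolding precedence_def
  proof (intro ballI impI)
    fix c x y
    assume c: "c \<in> creases k" and xy: "x \<in> wings c" "y \<in> wings c"
      and l: "light_up x" "\<not> light_up y"
    have f: "x \<in> faces k" "y \<in> faces k"
      using xy wings_subset_faces[OF c] by auto
    have "\<phi> x \<in> wings (\<psi> c)" "\<phi> y \<in> wings (\<psi> c)"
      using xy wings_\<psi>[OF c] by auto
    moreover have "light_up (\<phi> y)" "\<not> light_up (\<phi> x)"
      using l f light_up_\<phi> by auto
    ultimately show "(assigned Q c = Mountain \<longrightarrow> (x, y) \<in> relabel \<phi> \<Pi>) \<and>
        (assigned Q c = Valley \<longrightarrow> (y, x) \<in> relabel \<phi> \<Pi>)"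
      using prec \<psi>_creases[OF c] neg[OF c] f unfolding precedence_def iff by simp
  qed
  moreover have "noncrossing k (relabel \<phi> \<Pi>)"
    unfolding noncrossing_iff[OF \<Pi>']
  proof (intro ballI impI allI notI)
    fix c d x0 x1 y0 y1
    assume c: "c \<in> creases k" and d: "d \<in> creases k" and "target_class c = target_class d"
      and disj: "wings c \<inter> wings d = {}"
      and w: "wings c = {x0, x1}" "wings d = {y0, y1}"
      and cross: "(x0, y0) \<in> relabel \<phi> \<Pi> \<and> (y0, x1) \<in> relabel \<phi> \<Pi> \<and> (x1, y1) \<in> relabel \<phi> \<Pi>"
    have "target_class (\<psi> c) = target_class (\<psi> d)"
      using target_class_\<psi> c d \<open>target_class c = target_class d\<close> by simp
    \<comment> \<open>An involution on faces is injective there, so images of disjoint wing sets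
      stay disjoint.\<close>
    moreover have "wings (\<psi> c) \<inter> wings (\<psi> d) = {}"
    proof -
      have "inj_on \<phi> (faces k)"
        using \<phi>_\<phi> by (rule inj_on_inverseI)
      then have "\<phi> ` wings c \<inter> \<phi> ` wings d = \<phi> ` (wings c \<inter> wings d)"
        using inj_on_image_Int wings_subset_faces c d by metis
      with disj show ?thesis
        by (simp add: wings_\<psi> c d)
    qed
    moreover have "wings (\<psi> c) = {\<phi> x0, \<phi> x1}" "wings (\<psi> d) = {\<phi> y0, \<phi> y1}"
      using w wings_\<psi> c d by auto
    moreover have "(\<phi> x0, \<phi> y0) \<in> \<Pi>" "(\<phi> y0, \<phi> x1) \<in> \<Pi>" "(\<phi> x1, \<phi> y1) \<in> \<Pi>"
      using cross by (auto simp: iff)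
    ultimately show False
      using nc[unfolded noncrossing_iff[OF \<Pi>], rule_format, OF \<psi>_creases[OF c] \<psi>_creases[OF d]]
      by metis
  qed
  ultimately show ?thesis
    using \<Pi>' by (simp add: order_valid_def)
qed

end

section \<open>Row exchange and column reflection\<close>

fun swap_crease :: "crease \<Rightarrow> crease" where
  "swap_crease (HCrease c) = HCrease c"
| "swap_crease (UCrease i) = LCrease i"
| "swap_crease (LCrease i) = UCrease i"

text \<open>A seam is indexed by its left column. Columns i and i + 1 go to 2k + 1 - i and 2k - i,
  so the new left column is 2k - i, without the + 1 of the H-creases.\<close>

fun reflect_crease :: "nat \<Rightarrow> crease \<Rightarrow> crease" where
  "reflect_crease k (HCrease c) = HCrease (2 * k + 1 - c)"
| "reflect_crease k (UCrease i) = UCrease (2 * k - i)"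
| "reflect_crease k (LCrease i) = LCrease (2 * k - i)"

lemma faces_iff [simp]:
  "Upper c \<in> faces k \<longleftrightarrow> c \<in> {1..2 * k}" "Lower c \<in> faces k \<longleftrightarrow> c \<in> {1..2 * k}"
  by (auto simp: faces_def)

lemma creases_iff [simp]:
  "HCrease c \<in> creases k \<longleftrightarrow> c \<in> {1..2 * k}"
  "UCrease i \<in> creases k \<longleftrightarrow> i \<in> {1..2 * k - 1}"
  "LCrease i \<in> creases k \<longleftrightarrow> i \<in> {1..2 * k - 1}"
  by (auto simp: creases_def)

text \<open>Changing the row changes the parity that decides \<open>light_up\<close>, and seam
  indices, hence target classes, stay put.\<close>

interpretation swap: light_reversing k phi_R swap_crease for k
proof
  fix x assume x: "x \<in> faces k"
  show "phi_R x \<in> faces k" "phi_R (phi_R x) = x"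
    using x by (cases x; simp)+
  show "light_up (phi_R x) \<longleftrightarrow> \<not> light_up x"
    using x by (cases x) (auto simp: light_up_def)
next
  fix c assume c: "c \<in> creases k"
  show "swap_crease c \<in> creases k" "wings (swap_crease c) = phi_R ` wings c"
    "target_class (swap_crease c) = target_class c"
    using c by (cases c; auto)+
qed

text \<open>As 2k + 1 is odd, reflection changes the parity of every column; as 2k is even, it keeps
  that of every seam index, hence East and West.\<close>

interpretation reflect: light_reversing k "phi_H k" "reflect_crease k" for k
proof
  fix x assume x: "x \<in> faces k"
  show "phi_H k x \<in> faces k" "phi_H k (phi_H k x) = x"
    using x by (cases x; auto)+
  show "light_up (phi_H k x) \<longleftrightarrow> \<not> light_up x"
    using x by (cases x) (auto simp: light_up_def)
next
  fix c assume c: "c \<in> creases k"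
  show "reflect_crease k c \<in> creases k" "target_class (reflect_crease k c) = target_class c"
    using c by (cases c; auto)+
  show "wings (reflect_crease k c) = phi_H k ` wings c"
    using c by (cases c) (auto simp: Suc_diff_le)
qed

section \<open>Labels and local flat-foldability under the word actions\<close>

lemma assigned_C: "assigned (word_action C P) c = neg (assigned P c)"
  by (cases "(C, P)" rule: word_action.cases; cases c) auto

lemma assigned_swap: "assigned P (swap_crease c) = neg (assigned (word_action CR P) c)"
  by (cases "(CR, P)" rule: word_action.cases; cases c) auto

lemma assigned_reflect:
  assumes "c \<in> creases k"
  shows "assigned P (reflect_crease k c) = neg (assigned (word_action CH P) c)"
proof -
  obtain h0 h1 u0 u1 l0 l1 where P: "P = (h0, h1, u0, u1, l0, l1)"
    by (cases P) auto
  \<comment> \<open>Odd and even columns trade places, which is why \<open>CH\<close> exchanges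
    \<open>h0\<close> and \<open>h1\<close>; the next fact shows why \<open>u\<close> and
    \<open>l\<close> keep their order.\<close>
  have h: "(2 * k + 1 - c - 1) mod 2 = 0 \<longleftrightarrow> (c - 1) mod 2 \<noteq> 0" if "c \<in> {1..2 * k}" for c :: nat
    using that unfolding atLeastAtMost_iff by presburger
  have s: "(2 * k - i - 1) mod 2 = 0 \<longleftrightarrow> (i - 1) mod 2 = 0" if "i \<in> {1..2 * k - 1}" for i :: nat
    using that unfolding atLeastAtMost_iff by presburger
  show ?thesis
  proof (cases c)
    case (HCrease c)
    with assms h[of c] show ?thesis
      by (simp only: P creases_iff reflect_crease.simps word_action.simps assigned.simps)
        (cases "(c - 1) mod 2 = 0"; simp only: neg_neg if_True if_False simp_thms)
  next
    case (UCrease i)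
    with assms s[of i] show ?thesis
      by (simp only: P creases_iff reflect_crease.simps word_action.simps assigned.simps)
        (simp only: neg_neg if_distrib[of neg])
  next
    case (LCrease i)
    with assms s[of i] show ?thesis
      by (simp only: P creases_iff reflect_crease.simps word_action.simps assigned.simps)
        (simp only: neg_neg if_distrib[of neg])
  qed
qed

text \<open>The four creases at a vertex are distinct, so the parity of the count is an exclusive or
  of four truth values, in which exchanges and negations are easily traced.\<close>

lemma locally_flat_foldable_iff:
  "locally_flat_foldable P k \<longleftrightarrow>
     (\<forall>c\<in>{1..2 * k - 1}.
        ((assigned P (HCrease c) = Mountain) \<noteq> (assigned P (HCrease (c + 1)) = Mountain)) \<noteq>
        ((assigned P (UCrease c) = Mountain) \<noteq> (assigned P (LCrease c) = Mountain)))"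
proof -
  have "odd (card {x \<in> {a, b, c, d}. Q x}) \<longleftrightarrow> (Q a \<noteq> Q b) \<noteq> (Q c \<noteq> Q d)"
    if "distinct [a, b, c, d]" for a b c d :: crease and Q
  proof -
    have "card {x \<in> {a, b, c, d}. Q x} = (\<Sum>x\<in>{a, b, c, d}. if Q x then 1 else 0)"
      by (simp only: card_eq_sum sum.inter_filter finite.intros)
    then show ?thesis
      using that by auto
  qed
  then show ?thesis
    by (simp add: locally_flat_foldable_def)
qed

lemma word_action_word_action: "word_action g (word_action g P) = P"
  by (cases "(g, P)" rule: word_action.cases) auto

lemma word_action_R: "word_action R P = word_action C (word_action CR P)"
  by (cases "(R, P)" rule: word_action.cases) auto

lemma word_action_H: "word_action H P = word_action C (word_action CH P)"
  by (cases "(H, P)" rule: word_action.cases) auto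

text \<open>Since the two \<open>H\<close>-creases at a vertex carry the labels \<open>h\<^sub>0\<close> and \<open>h\<^sub>1\<close> in some order, the
  condition at a vertex is unaffected by exchanging these.\<close>

lemma locally_flat_foldable_word_action:
  assumes "locally_flat_foldable P k"
  shows "locally_flat_foldable (word_action g P) k"
proof -
  obtain h0 h1 u0 u1 l0 l1 where P: "P = (h0, h1, u0, u1, l0, l1)"
    by (cases P) auto
  have succ: "(c + 1 - 1) mod 2 = 0 \<longleftrightarrow> (c - 1) mod 2 \<noteq> 0" if "c \<in> {1..2 * k - 1}" for c :: nat
    using that by simp presburger
  \<comment> \<open>Phrased through \<open>Mountain\<close> alone, negating the labels flips all
    four truth values, and an even number of flips keeps the exclusive or.\<close>
  have not_mountain: "neg l = Mountain \<longleftrightarrow> \<not> l = Mountain" for l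
    by (cases l) simp_all
  show ?thesis
    unfolding locally_flat_foldable_iff
  proof
    fix c assume c: "c \<in> {1..2 * k - 1}"
    with assms have "((assigned P (HCrease c) = Mountain) \<noteq> (assigned P (HCrease (c + 1)) = Mountain)) \<noteq>
        ((assigned P (UCrease c) = Mountain) \<noteq> (assigned P (LCrease c) = Mountain))"
      unfolding locally_flat_foldable_iff by (rule bspec)
    then show "((assigned (word_action g P) (HCrease c) = Mountain) \<noteq>
          (assigned (word_action g P) (HCrease (c + 1)) = Mountain)) \<noteq>
        ((assigned (word_action g P) (UCrease c) = Mountain) \<noteq>
          (assigned (word_action g P) (LCrease c) = Mountain))"
      by (cases g; cases "(c - 1) mod 2 = 0";
         simp_all only: P word_action.simps assigned.simps succ[OF c] not_mountain if_True if_False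
          simp_thms; blast?)
  qed
qed

section \<open>The actions on orders and on the sets \<open>F P k\<close>\<close>

lemma strict_total_order_order_action:
  assumes "strict_total_order k \<Pi>"
  shows "strict_total_order k (order_action k g \<Pi>)"
proof -
  have conv: "strict_total_order k (converse \<Sigma>)" if "strict_total_order k \<Sigma>" for \<Sigma>
    using that by (auto simp: strict_total_order_iff irrefl_def)
  show ?thesis
    using assms
    by (cases g) (simp_all add: conv swap.strict_total_order_relabel
        reflect.strict_total_order_relabel)
qed

lemma order_action_order_action:
  assumes "strict_total_order k \<Pi>"
  shows "order_action k g (order_action k g \<Pi>) = \<Pi>"
proof -
  have sub: "\<Pi> \<subseteq> faces k \<times> faces k"
    using assms by (simp add: strict_total_order_iff)
  \<comment> \<open>Reversal commutes with relabelling, so the composites \<open>R\<close> and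
    \<open>H\<close> are involutions as well.\<close>
  have conv: "relabel \<phi> (converse \<Sigma>) = converse (relabel \<phi> \<Sigma>)" for \<phi> \<Sigma>
    by (auto simp: relabel_def)
  show ?thesis
    using swap.relabel_relabel[OF sub] reflect.relabel_relabel[OF sub]
    by (cases g) (simp_all add: conv)
qed

lemma F_iff: "\<Pi> \<in> F P k \<longleftrightarrow> locally_flat_foldable P k \<and> order_valid P k \<Pi>"
  by (simp add: F_def)

lemma order_action_in_F:
  assumes "\<Pi> \<in> F P k"
  shows "order_action k g \<Pi> \<in> F (word_action g P) k"
proof -
  have valid: "order_valid P k \<Pi>"
    using assms by (simp add: F_iff)
  have conv: "order_valid (word_action C Q) k (converse \<Sigma>)" if "order_valid Q k \<Sigma>" for Q \<Sigma>
    using that by (rule order_valid_converse) (rule assigned_C)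
  have CR: "order_valid (word_action CR P) k (relabel phi_R \<Pi>)"
    using valid by (rule swap.order_valid_relabel) (rule assigned_swap)
  have CH: "order_valid (word_action CH P) k (relabel (phi_H k) \<Pi>)"
    using valid by (rule reflect.order_valid_relabel) (rule assigned_reflect)
  have "order_valid (word_action g P) k (order_action k g \<Pi>)"
    using conv[OF valid] CR CH conv[OF CR] conv[OF CH]
    by (cases g) (simp_all add: word_action_R word_action_H)
  then show ?thesis
    using assms locally_flat_foldable_word_action by (simp add: F_iff)
qed

lemma F_strict_total_order: "\<Pi> \<in> F P k \<Longrightarrow> strict_total_order k \<Pi>"
  by (simp add: F_iff order_valid_def)

lemma bij_betw_order_action:
  "bij_betw (order_action k g) (F P k) (F (word_action g P) k)"
proof (rule bij_betw_byWitness[where f' = "order_action k g"])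
  show "order_action k g ` F (word_action g P) k \<subseteq> F P k"
    using order_action_in_F[of _ "word_action g P" k g] by (auto simp: word_action_word_action)
qed (auto simp: order_action_in_F order_action_order_action dest: F_strict_total_order)

lemma order_action_in_F_iff:
  assumes "strict_total_order k \<Pi>"
  shows "\<Pi> \<in> F P k \<longleftrightarrow> order_action k g \<Pi> \<in> F (word_action g P) k"
  using order_action_in_F[of \<Pi> P k g] order_action_in_F[of "order_action k g \<Pi>" "word_action g P" k g]
  by (auto simp: order_action_order_action[OF assms] word_action_word_action)

section \<open>Seams under reflection\<close>

text \<open>The upper wing pair already determines the index: it is never a lower pair, and p = q +
  1 together with p + 1 = q is impossible. This makes the reflected seam coordinate unique.\<close>

lemma wings_seam_eq_iff: "wings ` seam p = wings ` seam q \<longleftrightarrow> p = q"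
proof
  assume "wings ` seam p = wings ` seam q"
  then have "{Upper p, Upper (p + 1)} \<in> {{Upper q, Upper (q + 1)}, {Lower q, Lower (q + 1)}}"
    by (metis image_empty image_insert insertI1 seam_def wings.simps(2,3))
  then show "p = q"
    by (auto simp: doubleton_eq_iff)
qed simp

theorem proposition4p3:
  fixes k :: nat
  assumes "k \<ge> 2"
  shows "(\<forall>g P \<Pi>. strict_total_order k \<Pi> \<longrightarrow>
            strict_total_order k (order_action k g \<Pi>) \<and>
            (\<Pi> \<in> F P k \<longleftrightarrow> order_action k g \<Pi> \<in> F (word_action g P) k)) \<and>
         (\<forall>g P. F (word_action g P) k = order_action k g ` F P k \<and>
            bij_betw (order_action k g) (F P k) (F (word_action g P) k)) \<and>
         (\<forall>p\<in>{1..2 * k - 1}.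
            2 * k - p \<in> {1..2 * k - 1} \<and>
            phi_H k ` wings (UCrease p) = wings (UCrease (2 * k - p)) \<and>
            phi_H k ` wings (LCrease p) = wings (LCrease (2 * k - p)) \<and>
            (\<forall>q\<in>{1..2 * k - 1}.
               (\<lambda>c. phi_H k ` wings c) ` seam p = wings ` seam q \<longleftrightarrow> q = 2 * k - p))"
proof (intro conjI allI impI ballI)
  fix g P \<Pi> assume "strict_total_order k \<Pi>"
  then show "strict_total_order k (order_action k g \<Pi>)"
    "\<Pi> \<in> F P k \<longleftrightarrow> order_action k g \<Pi> \<in> F (word_action g P) k"
    by (rule strict_total_order_order_action, rule order_action_in_F_iff)
next
  fix g P
  show bij: "bij_betw (order_action k g) (F P k) (F (word_action g P) k)"
    by (rule bij_betw_order_action)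
  then show "F (word_action g P) k = order_action k g ` F P k"
    by (simp add: bij_betw_def)
next
  fix p assume p: "p \<in> {1..2 * k - 1}"
  then show "2 * k - p \<in> {1..2 * k - 1}"
    by auto
  show U: "phi_H k ` wings (UCrease p) = wings (UCrease (2 * k - p))"
    using reflect.wings_\<psi>[of "UCrease p" k] p by simp
  show L: "phi_H k ` wings (LCrease p) = wings (LCrease (2 * k - p))"
    using reflect.wings_\<psi>[of "LCrease p" k] p by simp
  fix q
  have "(\<lambda>c. phi_H k ` wings c) ` seam p = wings ` seam (2 * k - p)"
    unfolding seam_def image_insert image_empty U L ..
  then show "(\<lambda>c. phi_H k ` wings c) ` seam p = wings ` seam q \<longleftrightarrow> q = 2 * k - p"
    using wings_seam_eq_iff by auto
qed

end
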